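(* Let $X$ be a real Hilbert space, let $\mathcal{A}$ be a nonempty finite collection of closed affine subspaces of $X$, and let $\mathcal{L}$ be the collection of closed linear subspaces parallel to the members of $\mathcal{A}$. Suppose that $\mathcal{L}$ is innately regular and that $0<\lambda<2$. Let $Q$ be a finite composition of relaxed projectors drawn from $\mathcal{R}_{\mathcal{A},\lambda}=\{(1-\lambda)\mathrm{Id}+\lambda P_A : A\in\mathcal{A}\}$. Then $\operatorname{Fix}Q\neq\varnothing$ and for every $x_0\in X$, the sequence $(Q^nx_0)_{n\in\mathbb{N}}$ converges linearly to $P_{\operatorname{Fix}Q}(x_0)$.
   Context: $X$ is a real Hilbert space (possibly infinite-dimensional) with inner product $\langle\cdot,\cdot\rangle$ and induced norm $\|\cdot\|$. A closed affine subspace is a nonempty set $A=a+L$ with $a\in X$ and $L$ a closed linear subspace of $X$; then $L=A-A$ is the linear subspace parallel to (associated with) $A$, and $\mathcal{L}=\{A-A : A\in\mathcal{A}\}$. For a nonempty closed convex subset $C$ of $X$, $P_C$ denotes the orthogonal (nearest point) projector onto $C$; $\mathrm{Id}$ is the identity on $X$; $d_C(x):=\inf_{c\in C}\|x-c\|$; and $\operatorname{Fix}Q:=\{x\in X : Qx=x\}$. A sequence $(y_n)_{n\in\mathbb{N}}$ converges linearly to $y$ if there exist $\alpha\geq 0$ and $\rho\in[0,1)$ such that $\|y_n-y\|\leq\alpha\rho^n$ for all $n\in\mathbb{N}$ (here the constants may depend on the starting point $x_0$). A finite nonempty collection $\mathcal{M}$ of closed linear subspaces of $X$ is called regular if there exists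 a constant $\kappa>0$ such that $d_{\bigcap_{L\in\mathcal{M}}L}(x)\leq\kappa\max_{L\in\mathcal{M}}d_L(x)$ for all $x\in X$. The collection $\mathcal{L}$ is called innately regular if every (nonempty) subcollection of $\mathcal{L}$ is regular. *)

theory Defs
  imports "HOL-Analysis.Analysis"
begin

text \<open>
  A real Hilbert space, possibly infinite-dimensional, is a type of sort
  \<open>{real_inner, banach}\<close>: a real inner product space that is complete for the
  norm induced by the inner product.
\<close>

definition closed_affine_subspace :: "'a::real_inner set \<Rightarrow> bool" where
  "closed_affine_subspace A \<longleftrightarrow> (\<exists>a L. subspace L \<and> closed L \<and> A = (\<lambda>x. a + x) ` L)"

text \<open>
  The Minkowski difference \<open>A - A\<close>; the operator \<open>-\<close> on sets is
  set difference and cannot be used for it.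
\<close>

definition parallel_subspace :: "'a::real_inner set \<Rightarrow> 'a set" where
  "parallel_subspace A = {x - y | x y. x \<in> A \<and> y \<in> A}"

text \<open>
  The nearest point projector. The defining formula is that of
  \<^const>\<open>closest_point\<close>, which is not used because its type requires
  \<open>heine_borel\<close> and hence excludes infinite-dimensional spaces.
  In a Hilbert space the nearest point exists and is unique when \<open>C\<close> is
  nonempty, closed and convex.
\<close>

definition projector :: "'a::real_inner set \<Rightarrow> 'a \<Rightarrow> 'a" where
  "projector C x = (SOME p. p \<in> C \<and> (\<forall>c\<in>C. dist x p \<le> dist x c))"

definition relaxed_projector :: "real \<Rightarrow> 'a::real_inner set \<Rightarrow> 'a \<Rightarrow> 'a" where
  "relaxed_projector lam A x = (1 - lam) *\<^sub>R x + lam *\<^sub>R projector A x"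

definition relaxed_projectors :: "real \<Rightarrow> 'a::real_inner set set \<Rightarrow> ('a \<Rightarrow> 'a) set" where
  "relaxed_projectors lam \<A> = relaxed_projector lam ` \<A>"

text \<open>
  Finite compositions \<open>R\<^sub>1 \<circ> \<dots> \<circ> R\<^sub>m\<close> of members of \<open>\<R>\<close>, with repetitions
  and in any order; the empty composition is the identity.
\<close>

definition finite_compositions :: "('a \<Rightarrow> 'a) set \<Rightarrow> ('a \<Rightarrow> 'a) set" where
  "finite_compositions \<R> = {foldr (\<circ>) Rs id | Rs. set Rs \<subseteq> \<R>}"

definition Fix :: "('a \<Rightarrow> 'a) \<Rightarrow> 'a set" where
  "Fix Q = {x. Q x = x}"

definition converges_linearly :: "(nat \<Rightarrow> 'a::real_normed_vector) \<Rightarrow> 'a \<Rightarrow> bool" where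
  "converges_linearly y l \<longleftrightarrow>
     (\<exists>\<alpha> \<rho>. 0 \<le> \<alpha> \<and> 0 \<le> \<rho> \<and> \<rho> < 1 \<and> (\<forall>n. norm (y n - l) \<le> \<alpha> * \<rho> ^ n))"

text \<open>
  Intended for finite nonempty collections of closed linear subspaces, so that the
  maximum is attained and \<^const>\<open>infdist\<close> is taken only to nonempty sets.
\<close>

definition regular_collection :: "'a::real_inner set set \<Rightarrow> bool" where
  "regular_collection \<M> \<longleftrightarrow>
     (\<exists>\<kappa>>0. \<forall>x. infdist x (\<Inter>\<M>) \<le> \<kappa> * Max ((\<lambda>L. infdist x L) ` \<M>))"

definition innately_regular :: "'a::real_inner set set \<Rightarrow> bool" where
  "innately_regular \<L> \<longleftrightarrow> (\<forall>\<M>. \<M> \<subseteq> \<L> \<and> \<M> \<noteq> {} \<longrightarrow> regular_collection \<M>)"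

end

theory Submission
  imports Defs
begin

text \<open>
  Let \<open>M\<close> be the intersection of the subspaces parallel to the factors of \<open>Q\<close>. Every step of \<open>Q\<close>
  moves the point orthogonally to \<open>M\<close>, so \<open>Q\<close> maps each coset \<open>x\<^sub>0 + M\<^sup>\<bottom>\<close> into itself. A factor
  decreases the squared distance of two points \<open>x, y\<close> by \<open>\<lambda> (2 - \<lambda>) d\<^sub>L(x - y)\<^sup>2\<close>; hence
  the total decrease under \<open>Q\<close> controls every \<open>d\<^sub>L(x - y)\<^sup>2\<close>, and regularity turns this into a
  multiple of \<open>\<parallel>x - y\<parallel>\<^sup>2\<close> when \<open>x - y \<in> M\<^sup>\<bottom>\<close>. So \<open>Q\<close> is a strict contraction on
  \<open>x\<^sub>0 + M\<^sup>\<bottom>\<close>, and Banach's theorem yields a fixed point there together with linear convergence.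
  Two fixed points of \<open>Q\<close> differ by an element of \<open>M\<close>, so that fixed point is the projection of \<open>x\<^sub>0\<close>.
\<close>

section \<open>Projections in Hilbert space\<close>

text \<open>A minimising sequence in \<open>C\<close> is Cauchy by the parallelogram law, and its
  limit, which exists by completeness, lies in \<open>C\<close> and attains the distance.\<close>

lemma nearest_point_exists:
  fixes C :: "'a::{real_inner, banach} set"
  assumes "convex C" and "closed C" and "C \<noteq> {}"
  shows "\<exists>p\<in>C. \<forall>c\<in>C. dist x p \<le> dist x c"
proof -
  define d where "d = infdist x C"
  have d0: "0 \<le> d"
    by (simp add: d_def infdist_nonneg)
  have d_le: "d \<le> dist x c" if "c \<in> C" for c
    using that by (simp add: d_def infdist_le)
  have "\<exists>c\<in>C. (dist x c)\<^sup>2 < d\<^sup>2 + inverse (real (Suc n))" for n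
  proof -
    have "d < sqrt (d\<^sup>2 + inverse (real (Suc n)))"
      using d0 by (simp add: real_less_rsqrt)
    then obtain c where "c \<in> C" and c: "dist x c < sqrt (d\<^sup>2 + inverse (real (Suc n)))"
      using \<open>C \<noteq> {}\<close> unfolding d_def infdist_notempty[OF \<open>C \<noteq> {}\<close>]
      by (subst (asm) cINF_less_iff) auto
    have "(dist x c)\<^sup>2 < (sqrt (d\<^sup>2 + inverse (real (Suc n))))\<^sup>2"
      using c by (intro power_strict_mono) auto
    with \<open>c \<in> C\<close> show ?thesis
      by (auto simp: add_nonneg_nonneg)
  qed
  then obtain c where cC: "\<And>n. c n \<in> C"
    and c: "\<And>n. (dist x (c n))\<^sup>2 < d\<^sup>2 + inverse (real (Suc n))"
    by metis
  have close: "(dist (c m) (c n))\<^sup>2 \<le> 2 * inverse (real (Suc m)) + 2 * inverse (real (Suc n))" for m n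
  proof -
    \<comment> \<open>The midpoint lies in \<open>C\<close> by convexity, so its distance to
      \<open>x\<close> is at least \<open>d\<close>; the parallelogram law then bounds the distance
      between the two terms.\<close>
    define z where "z = (1/2) *\<^sub>R c m + (1/2) *\<^sub>R c n"
    have "z \<in> C"
      unfolding z_def using \<open>convex C\<close> cC by (intro convexD) auto
    then have "d\<^sup>2 \<le> (dist x z)\<^sup>2"
      using d_le d0 by (intro power_mono) auto
    moreover have "(dist (c m) (c n))\<^sup>2 = 2 * (dist x (c m))\<^sup>2 + 2 * (dist x (c n))\<^sup>2 - 4 * (dist x z)\<^sup>2"
      unfolding z_def dist_norm power2_norm_eq_inner
      by (simp add: algebra_simps inner_commute)
    ultimately show ?thesis
      using c[of m] c[of n] by linarith
  qed
  have "Cauchy c"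
  proof (rule metric_CauchyI)
    fix e :: real
    assume "0 < e"
    then obtain N where N: "inverse (real (Suc N)) < e\<^sup>2 / 4"
      using reals_Archimedean[of "e\<^sup>2 / 4"] by auto
    have "dist (c m) (c n) < e" if "m \<ge> N" "n \<ge> N" for m n
    proof (rule power_less_imp_less_base)
      have "inverse (real (Suc m)) \<le> inverse (real (Suc N))"
        and "inverse (real (Suc n)) \<le> inverse (real (Suc N))"
        using that by (simp_all add: le_imp_inverse_le)
      then show "(dist (c m) (c n))\<^sup>2 < e\<^sup>2"
        using close[of m n] N by linarith
    qed (use \<open>0 < e\<close> in simp)
    then show "\<exists>N. \<forall>m\<ge>N. \<forall>n\<ge>N. dist (c m) (c n) < e"
      by blast
  qed
  then obtain p where p: "c \<longlonglongrightarrow> p"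
    using Cauchy_convergent convergent_def by blast
  have "p \<in> C"
    using \<open>closed C\<close> cC p closed_sequentially by blast
  have "(\<lambda>n. (dist x (c n))\<^sup>2) \<longlonglongrightarrow> (dist x p)\<^sup>2"
    using p by (intro tendsto_intros)
  moreover have "(\<lambda>n. d\<^sup>2 + inverse (real (Suc n))) \<longlonglongrightarrow> d\<^sup>2 + 0"
    by (intro tendsto_intros LIMSEQ_inverse_real_of_nat)
  ultimately have "(dist x p)\<^sup>2 \<le> d\<^sup>2 + 0"
    by (rule LIMSEQ_le) (use c less_imp_le in blast)
  then have "dist x p \<le> d"
    using power2_le_imp_le[OF _ d0] by simp
  with \<open>p \<in> C\<close> d_le show ?thesis
    by (meson order_trans)
qed

section \<open>Affine subspaces and orthogonality\<close>

lemma parallel_subspace_translation: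
  assumes "subspace L"
  shows "parallel_subspace ((\<lambda>x. a + x) ` L) = L"
proof
  show "parallel_subspace ((\<lambda>x. a + x) ` L) \<subseteq> L"
    using assms by (auto simp: parallel_subspace_def subspace_diff)
next
  have "\<exists>x y. z = x - y \<and> x \<in> (\<lambda>x. a + x) ` L \<and> y \<in> (\<lambda>x. a + x) ` L" if "z \<in> L" for z
    using that subspace_0[OF assms] by (intro exI[of _ "a + z"] exI[of _ "a + 0"]) auto
  then show "L \<subseteq> parallel_subspace ((\<lambda>x. a + x) ` L)"
    by (auto simp: parallel_subspace_def)
qed

lemma closed_affine_subspace_parallel:
  assumes "closed_affine_subspace A"
  shows "subspace (parallel_subspace A)" and "closed (parallel_subspace A)"
  using assms by (auto simp: closed_affine_subspace_def parallel_subspace_translation)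

lemma inner_orthogonal_comp:
  assumes "u \<in> W" and "v \<in> W\<^sup>\<bottom>"
  shows "u \<bullet> v = 0"
  using assms by (simp add: orthogonal_comp_def orthogonal_def)

lemma closed_orthogonal_comp: "closed (W\<^sup>\<bottom>)"
proof -
  have "W\<^sup>\<bottom> = (\<Inter>y\<in>W. {x. y \<bullet> x = 0})"
    by (auto simp: orthogonal_comp_def orthogonal_def)
  then show ?thesis
    by (auto intro!: closed_Collect_eq continuous_intros)
qed

text \<open>The nearest point satisfies the variational inequality for convex sets. Directions in
  \<open>L\<close> come in pairs \<open>l\<close>, \<open>- l\<close>, which turns the inequality
  into orthogonality.\<close>

lemma projector_affine:
  fixes A :: "'a::{real_inner, banach} set"
  assumes "closed_affine_subspace A"
  shows "projector A x \<in> A" and "x - projector A x \<in> (parallel_subspace A)\<^sup>\<bottom>"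
proof -
  obtain a L where L: "subspace L" "closed L" and A: "A = (\<lambda>x. a + x) ` L"
    using assms by (auto simp: closed_affine_subspace_def)
  have "convex A" "closed A" "A \<noteq> {}"
    using L subspace_0[OF L(1)]
    by (auto simp: A convex_translation subspace_imp_convex closed_translation)
  from someI_ex[OF nearest_point_exists[OF this, of x, unfolded Bex_def]]
  have p: "projector A x \<in> A" "\<forall>c\<in>A. dist x (projector A x) \<le> dist x c"
    by (simp_all add: projector_def)
  show "projector A x \<in> A"
    by fact
  then obtain b where b: "b \<in> L" "projector A x = a + b"
    by (auto simp: A)
  have le0: "(x - projector A x) \<bullet> l \<le> 0" if "l \<in> L" for l
  proof -
    have "projector A x + l \<in> A"
      using b that L(1) by (auto simp: A subspace_add add.assoc)
    from any_closest_point_dot[OF \<open>convex A\<close> \<open>closed A\<close> p(1) this p(2)] show ?thesis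
      by simp
  qed
  have "(x - projector A x) \<bullet> l = 0" if "l \<in> L" for l
    using le0[OF that] le0[of "- l"] that L(1) by (simp add: subspace_neg)
  then show "x - projector A x \<in> (parallel_subspace A)\<^sup>\<bottom>"
    by (simp add: A parallel_subspace_translation[OF L(1)] orthogonal_comp_def orthogonal_def
        inner_commute)
qed

text \<open>Pythagoras. This lets regularity, a statement about distances to the intersection, bound
  the norm itself on the orthogonal complement.\<close>

lemma norm_le_infdist_orthogonal_comp:
  assumes "u \<in> M\<^sup>\<bottom>" and "M \<noteq> {}"
  shows "norm u \<le> infdist u M"
  unfolding infdist_notempty[OF assms(2)]
proof (rule cINF_greatest[OF assms(2)])
  fix m
  assume "m \<in> M"
  then have "m \<bullet> u = 0"
    using assms(1) by (rule inner_orthogonal_comp)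
  then have "(norm (u - m))\<^sup>2 = (norm u)\<^sup>2 + (norm m)\<^sup>2"
    by (simp add: power2_norm_eq_inner inner_diff_left inner_diff_right inner_commute[of u m])
  then have "(norm u)\<^sup>2 \<le> (norm (u - m))\<^sup>2"
    using zero_le_power2[of "norm m"] by linarith
  then show "norm u \<le> dist u m"
    unfolding dist_norm by (rule power2_le_imp_le) (rule norm_ge_zero)
qed

section \<open>Relaxed projectors and their compositions\<close>

lemma relaxed_projector_displacement:
  fixes A :: "'a::{real_inner, banach} set"
  assumes "closed_affine_subspace A"
  shows "relaxed_projector lam A x - x \<in> (parallel_subspace A)\<^sup>\<bottom>"
proof -
  have "relaxed_projector lam A x - x = (- lam) *\<^sub>R (x - projector A x)"
    by (simp add: relaxed_projector_def algebra_simps)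
  then show ?thesis
    using projector_affine(2)[OF assms] by (simp add: subspace_orthogonal_comp subspace_scale
        del: scaleR_minus_left)
qed

text \<open>Split \<open>x - y = v + e\<close> with \<open>v\<close> in the parallel subspace and
  \<open>e\<close> orthogonal to it. The map keeps \<open>v\<close> and multiplies \<open>e\<close>
  by \<open>1 - lam\<close>, so the squared norm drops by \<open>lam * (2 - lam)\<close> times that
  of \<open>e\<close>. The numerator of \<open>K\<close> is chosen to dominate both the squared
  distance (factor 1) and the squared displacement (factor \<open>lam\<^sup>2\<close>).\<close>

lemma relaxed_projector_decrease:
  fixes A :: "'a::{real_inner, banach} set" and lam :: real
  defines "R \<equiv> relaxed_projector lam A"
  assumes "closed_affine_subspace A" and "0 < lam" and "lam < 2"
  defines "K \<equiv> (1 + lam\<^sup>2) / (lam * (2 - lam))"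
  shows "(infdist (x - y) (parallel_subspace A))\<^sup>2 \<le> K * ((norm (x - y))\<^sup>2 - (norm (R x - R y))\<^sup>2)"
    and "(norm ((R x - R y) - (x - y)))\<^sup>2 \<le> K * ((norm (x - y))\<^sup>2 - (norm (R x - R y))\<^sup>2)"
    and "norm (R x - R y) \<le> norm (x - y)"
proof -
  define L where "L = parallel_subspace A"
  define v where "v = projector A x - projector A y"
  define e where "e = (x - projector A x) - (y - projector A y)"
  note proj = projector_affine[OF assms(2)]
  have "v \<in> L"
    unfolding L_def v_def parallel_subspace_def using proj(1) by blast
  have "e \<in> L\<^sup>\<bottom>"
    unfolding L_def e_def by (rule subspace_diff[OF subspace_orthogonal_comp proj(2) proj(2)])
  then have ve: "v \<bullet> e = 0"
    using \<open>v \<in> L\<close> by (rule inner_orthogonal_comp[rotated])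
  have xy: "x - y = v + e"
    by (simp add: v_def e_def)
  have R: "R x - R y = v + (1 - lam) *\<^sub>R e"
    by (simp add: R_def relaxed_projector_def v_def e_def algebra_simps)
  have pos: "0 < lam * (2 - lam)"
    using assms(3,4) by simp
  have decrease: "(norm (x - y))\<^sup>2 - (norm (R x - R y))\<^sup>2 = lam * (2 - lam) * (norm e)\<^sup>2"
    unfolding xy R power2_norm_eq_inner
    by (simp add: inner_add_left inner_add_right ve inner_commute[of e v])
       (simp add: algebra_simps power2_eq_square)
  then have K: "K * ((norm (x - y))\<^sup>2 - (norm (R x - R y))\<^sup>2) = (1 + lam\<^sup>2) * (norm e)\<^sup>2"
    using assms(3,4) by (simp add: K_def)
  have "infdist (x - y) L \<le> norm e"
    using \<open>v \<in> L\<close> by (rule infdist_le2) (simp add: xy dist_norm)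
  then have "(infdist (x - y) L)\<^sup>2 \<le> (norm e)\<^sup>2"
    by (intro power_mono infdist_nonneg)
  then show "(infdist (x - y) (parallel_subspace A))\<^sup>2 \<le> K * ((norm (x - y))\<^sup>2 - (norm (R x - R y))\<^sup>2)"
    unfolding K L_def by (simp add: distrib_right add_increasing2)
  have "(R x - R y) - (x - y) = (- lam) *\<^sub>R e"
    unfolding R xy by (simp add: algebra_simps)
  then show "(norm ((R x - R y) - (x - y)))\<^sup>2 \<le> K * ((norm (x - y))\<^sup>2 - (norm (R x - R y))\<^sup>2)"
    unfolding K by (simp add: power_mult_distrib distrib_right)
  have "0 \<le> lam * (2 - lam) * (norm e)\<^sup>2"
    by (rule mult_nonneg_nonneg[OF less_imp_le[OF pos] zero_le_power2])
  then show "norm (R x - R y) \<le> norm (x - y)"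
    using decrease by (intro power2_le_imp_le[OF _ norm_ge_zero]) linarith
qed

section \<open>Compositions: displacement and decrease\<close>

lemma square_sum_bound:
  fixes a b c :: real
  assumes "c \<le> a + b" and "0 \<le> c"
  shows "c\<^sup>2 \<le> 2 * a\<^sup>2 + 2 * b\<^sup>2"
proof -
  have "c\<^sup>2 \<le> (a + b)\<^sup>2"
    using assms by (intro power_mono) auto
  also have "\<dots> \<le> 2 * a\<^sup>2 + 2 * b\<^sup>2"
    using sum_squares_bound[of a b] by (simp add: power2_sum)
  finally show ?thesis .
qed

text \<open>Indexed by the list of sets rather than of maps, so that the parallel subspaces of the
  factors stay accessible. The head of the list acts last.\<close>

definition relaxed_composition :: "real \<Rightarrow> 'a::real_inner set list \<Rightarrow> 'a \<Rightarrow> 'a" where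
  "relaxed_composition lam As = foldr (\<circ>) (map (relaxed_projector lam) As) id"

lemma relaxed_composition_simps [simp]:
  "relaxed_composition lam [] x = x"
  "relaxed_composition lam (A # As) x = relaxed_projector lam A (relaxed_composition lam As x)"
  by (simp_all add: relaxed_composition_def)

text \<open>The displacements of the single factors add up. Each is orthogonal to its own subspace,
  hence to the smaller intersection.\<close>

lemma relaxed_composition_displacement:
  fixes As :: "'a::{real_inner, banach} set list"
  assumes "\<And>A. A \<in> set As \<Longrightarrow> closed_affine_subspace A"
  shows "relaxed_composition lam As x - x \<in> (\<Inter>(parallel_subspace ` set As))\<^sup>\<bottom>"
  using assms
proof (induction As)
  case Nil
  then show ?case by simp
next
  case (Cons A As)
  let ?q = "relaxed_composition lam As x"
  let ?M = "\<Inter>(parallel_subspace ` set (A # As))"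
  have "relaxed_projector lam A ?q - ?q \<in> (parallel_subspace A)\<^sup>\<bottom>"
    using Cons.prems by (intro relaxed_projector_displacement) simp
  then have "relaxed_projector lam A ?q - ?q \<in> ?M\<^sup>\<bottom>"
    using orthogonal_comp_anti_mono[of ?M "parallel_subspace A"] by auto
  moreover have "?q - x \<in> ?M\<^sup>\<bottom>"
    using Cons orthogonal_comp_anti_mono[of ?M "\<Inter>(parallel_subspace ` set As)"] by auto
  ultimately have "(relaxed_projector lam A ?q - ?q) + (?q - x) \<in> ?M\<^sup>\<bottom>"
    by (rule subspace_add[OF subspace_orthogonal_comp])
  then show ?case
    by simp
qed

text \<open>The displacement bound strengthens the induction: a new factor controls the distance to
  its subspace only from the difference already moved by the earlier factors, and this bound carries
  the estimate back to \<open>x - y\<close>.\<close>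

lemma relaxed_composition_decrease:
  fixes As :: "'a::{real_inner, banach} set list"
  assumes "\<And>A. A \<in> set As \<Longrightarrow> closed_affine_subspace A" and "0 < lam" and "lam < 2"
  shows "\<exists>C\<ge>0. \<forall>x y. let Q = relaxed_composition lam As;
      D = (norm (x - y))\<^sup>2 - (norm (Q x - Q y))\<^sup>2
    in 0 \<le> D \<and> (\<forall>A\<in>set As. (infdist (x - y) (parallel_subspace A))\<^sup>2 \<le> C * D) \<and>
       (norm ((Q x - Q y) - (x - y)))\<^sup>2 \<le> C * D"
  using assms(1)
proof (induction As)
  case Nil
  then show ?case
    by (auto simp: Let_def)
next
  case (Cons A As)
  define Q where "Q = relaxed_composition lam As"
  define R where "R = relaxed_projector lam A"
  define K where "K = (1 + lam\<^sup>2) / (lam * (2 - lam))"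
  have "0 \<le> K"
    using assms(2,3) by (simp add: K_def)
  have A: "closed_affine_subspace A"
    using Cons.prems by simp
  note step = relaxed_projector_decrease[OF A assms(2,3), folded R_def K_def]
  obtain C where "0 \<le> C" and C: "\<And>x y. 0 \<le> (norm (x - y))\<^sup>2 - (norm (Q x - Q y))\<^sup>2"
      "\<And>x y B. B \<in> set As \<Longrightarrow> (infdist (x - y) (parallel_subspace B))\<^sup>2
         \<le> C * ((norm (x - y))\<^sup>2 - (norm (Q x - Q y))\<^sup>2)"
      "\<And>x y. (norm ((Q x - Q y) - (x - y)))\<^sup>2 \<le> C * ((norm (x - y))\<^sup>2 - (norm (Q x - Q y))\<^sup>2)"
    using Cons unfolding Let_def Q_def by auto
  have "0 \<le> (norm (x - y))\<^sup>2 - (norm (R (Q x) - R (Q y)))\<^sup>2 \<and>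
      (\<forall>B\<in>set (A # As). (infdist (x - y) (parallel_subspace B))\<^sup>2
         \<le> (2 * C + 2 * K) * ((norm (x - y))\<^sup>2 - (norm (R (Q x) - R (Q y)))\<^sup>2)) \<and>
      (norm ((R (Q x) - R (Q y)) - (x - y)))\<^sup>2
         \<le> (2 * C + 2 * K) * ((norm (x - y))\<^sup>2 - (norm (R (Q x) - R (Q y)))\<^sup>2)" for x y
  proof -
    \<comment> \<open>The difference of the two points before the composition, after the tail, and
      after the last factor; \<open>D\<close> and \<open>D'\<close> are the two successive
      decreases.\<close>
    define w where "w = x - y"
    define w' where "w' = Q x - Q y"
    define w'' where "w'' = R (Q x) - R (Q y)"
    define D where "D = (norm w)\<^sup>2 - (norm w')\<^sup>2"
    define D' where "D' = (norm w')\<^sup>2 - (norm w'')\<^sup>2"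
    note C = C(1,3)[of x y, folded w_def w'_def, folded D_def]
      C(2)[of _ x y, folded w_def w'_def, folded D_def]
    note step = step[of "Q x" "Q y", folded w'_def w''_def, folded D'_def]
    have "0 \<le> D" and "0 \<le> D'"
      using C(1) step(3) by (simp_all add: D'_def power_mono)
    have nonneg: "0 \<le> C * D" "0 \<le> C * D'" "0 \<le> K * D" "0 \<le> K * D'"
      using \<open>0 \<le> C\<close> \<open>0 \<le> K\<close> \<open>0 \<le> D\<close> \<open>0 \<le> D'\<close> by simp_all
    have total: "(norm w)\<^sup>2 - (norm w'')\<^sup>2 = D + D'"
      by (simp add: D_def D'_def)
    \<comment> \<open>The constant \<open>2 * C + 2 * K\<close> comes from
      \<open>square_sum_bound\<close>, applied to one term bounded by \<open>C * D\<close> and one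
      bounded by \<open>K * D'\<close>.\<close>
    have "(infdist w (parallel_subspace B))\<^sup>2 \<le> (2 * C + 2 * K) * (D + D')"
      if "B \<in> set (A # As)" for B
    proof (cases "B = A")
      case True
      \<comment> \<open>The distance to a set is 1-Lipschitz, so passing from \<open>w'\<close> back
        to \<open>w\<close> costs at most the displacement of the tail.\<close>
      have "infdist w (parallel_subspace A) \<le> infdist w' (parallel_subspace A) + norm (w' - w)"
        using infdist_triangle[of w _ w'] by (simp add: dist_norm norm_minus_commute)
      from square_sum_bound[OF this infdist_nonneg]
      have "(infdist w (parallel_subspace A))\<^sup>2 \<le> 2 * (K * D') + 2 * (C * D)"
        using step(1) C(2) by linarith
      then show ?thesis
        using nonneg True by (simp add: algebra_simps)
    next
      case False
      then have "(infdist w (parallel_subspace B))\<^sup>2 \<le> C * D"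
        using that C(3) by simp
      then show ?thesis
        using nonneg by (simp add: algebra_simps)
    qed
    moreover have "(norm (w'' - w))\<^sup>2 \<le> (2 * C + 2 * K) * (D + D')"
    proof -
      have "norm (w'' - w) \<le> norm (w'' - w') + norm (w' - w)"
        using norm_triangle_ineq[of "w'' - w'" "w' - w"] by simp
      from square_sum_bound[OF this norm_ge_zero]
      have "(norm (w'' - w))\<^sup>2 \<le> 2 * (K * D') + 2 * (C * D)"
        using step(2) C(2) by linarith
      then show ?thesis
        using nonneg by (simp add: algebra_simps)
    qed
    ultimately show ?thesis
      using \<open>0 \<le> D\<close> \<open>0 \<le> D'\<close> unfolding w_def[symmetric] w''_def[symmetric] total by simp
  qed
  then show ?case
    using \<open>0 \<le> C\<close> \<open>0 \<le> K\<close> unfolding Let_def Q_def R_def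
    by (intro exI[of _ "2 * C + 2 * K"]) simp
qed

section \<open>Contraction and fixed points\<close>

text \<open>Orthogonality to the intersection and regularity bound the norm of \<open>x - y\<close>
  by a multiple of its largest distance to one of the subspaces, and the decrease under the
  composition bounds that distance.\<close>

lemma relaxed_composition_contraction:
  fixes As :: "'a::{real_inner, banach} set list"
  assumes "\<And>A. A \<in> set As \<Longrightarrow> closed_affine_subspace A" and "0 < lam" and "lam < 2"
    and "As \<noteq> [] \<Longrightarrow> regular_collection (parallel_subspace ` set As)"
  shows "\<exists>\<rho>\<ge>0. \<rho> < 1 \<and> (\<forall>x y. x - y \<in> (\<Inter>(parallel_subspace ` set As))\<^sup>\<bottom> \<longrightarrow>
    norm (relaxed_composition lam As x - relaxed_composition lam As y) \<le> \<rho> * norm (x - y))"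
proof (cases "As = []")
  case True
  then show ?thesis
    \<comment> \<open>The empty intersection is the whole space, whose orthogonal complement is
      zero; so \<open>x = y\<close> and the factor 0 works.\<close>
    by (auto intro!: exI[of _ 0])
next
  case False
  define Q where "Q = relaxed_composition lam As"
  define M where "M = \<Inter>(parallel_subspace ` set As)"
  obtain \<kappa> where "\<kappa> > 0"
    and \<kappa>: "\<And>u. infdist u M \<le> \<kappa> * Max ((\<lambda>L. infdist u L) ` parallel_subspace ` set As)"
    using assms(4)[OF False] by (auto simp: regular_collection_def M_def)
  have "0 \<in> M"
    using closed_affine_subspace_parallel(1)[OF assms(1)] by (auto simp: M_def subspace_0)
  obtain C where "0 \<le> C" and C: "\<And>x y. 0 \<le> (norm (x - y))\<^sup>2 - (norm (Q x - Q y))\<^sup>2"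
      "\<And>x y B. B \<in> set As \<Longrightarrow> (infdist (x - y) (parallel_subspace B))\<^sup>2
         \<le> C * ((norm (x - y))\<^sup>2 - (norm (Q x - Q y))\<^sup>2)"
    using relaxed_composition_decrease[OF assms(1-3)] unfolding Let_def Q_def by metis
  define c where "c = \<kappa>\<^sup>2 * C"
  have "0 \<le> c"
    using \<open>0 \<le> C\<close> by (simp add: c_def)
  have "norm (Q x - Q y) \<le> sqrt (c / (c + 1)) * norm (x - y)" if xy: "x - y \<in> M\<^sup>\<bottom>" for x y
  proof -
    define D where "D = (norm (x - y))\<^sup>2 - (norm (Q x - Q y))\<^sup>2"
    have "Max ((\<lambda>L. infdist (x - y) L) ` parallel_subspace ` set As)
        \<in> (\<lambda>L. infdist (x - y) L) ` parallel_subspace ` set As"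
      using False by (intro Max_in) auto
    then obtain B where B: "B \<in> set As"
      "Max ((\<lambda>L. infdist (x - y) L) ` parallel_subspace ` set As)
        = infdist (x - y) (parallel_subspace B)"
      by auto
    have "norm (x - y) \<le> infdist (x - y) M"
      using norm_le_infdist_orthogonal_comp[OF xy] \<open>0 \<in> M\<close> by blast
    also have "\<dots> \<le> \<kappa> * infdist (x - y) (parallel_subspace B)"
      using \<kappa>[of "x - y"] B(2) by simp
    finally have "(norm (x - y))\<^sup>2 \<le> (\<kappa> * infdist (x - y) (parallel_subspace B))\<^sup>2"
      by (intro power_mono) auto
    also have "\<dots> \<le> \<kappa>\<^sup>2 * (C * D)"
      using C(2)[OF B(1), of x y] by (simp add: power_mult_distrib D_def mult_left_mono)
    finally have "(norm (x - y))\<^sup>2 \<le> c * D"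
      by (simp add: c_def)
    \<comment> \<open>Adds nonexpansiveness to the previous bound. The resulting ratio
      \<open>c / (c + 1)\<close> is in [0, 1) for every \<open>c\<close> \<ge> 0, including
      \<open>c = 0\<close>.\<close>
    then have "(norm (Q x - Q y))\<^sup>2 * (c + 1) \<le> c * (norm (x - y))\<^sup>2"
      using C(1)[of x y] unfolding D_def right_diff_distrib distrib_left mult.commute[of _ c] by linarith
    then have "(norm (Q x - Q y))\<^sup>2 \<le> c / (c + 1) * (norm (x - y))\<^sup>2"
      using \<open>0 \<le> c\<close> by (simp add: field_simps)
    then have "(norm (Q x - Q y))\<^sup>2 \<le> (sqrt (c / (c + 1)) * norm (x - y))\<^sup>2"
      using \<open>0 \<le> c\<close> by (simp add: power_mult_distrib)
    then show ?thesis
      by (rule power2_le_imp_le) (use \<open>0 \<le> c\<close> in simp)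
  qed
  then show ?thesis
    using \<open>0 \<le> c\<close> unfolding Q_def M_def by (intro exI[of _ "sqrt (c / (c + 1))"]) auto
qed

text \<open>Between two fixed points the norm does not decrease, so their difference has distance
  zero to each parallel subspace, which is closed.\<close>

lemma fixed_points_diff_parallel:
  fixes As :: "'a::{real_inner, banach} set list"
  assumes "\<And>A. A \<in> set As \<Longrightarrow> closed_affine_subspace A" and "0 < lam" and "lam < 2"
    and "p \<in> Fix (relaxed_composition lam As)" and "q \<in> Fix (relaxed_composition lam As)"
  shows "p - q \<in> \<Inter>(parallel_subspace ` set As)"
proof -
  define Q where "Q = relaxed_composition lam As"
  have fixed: "Q p = p" "Q q = q"
    using assms(4,5) by (simp_all add: Fix_def Q_def)
  obtain C where "\<And>x y B. B \<in> set As \<Longrightarrow> (infdist (x - y) (parallel_subspace B))\<^sup>2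
         \<le> C * ((norm (x - y))\<^sup>2 - (norm (Q x - Q y))\<^sup>2)"
    using relaxed_composition_decrease[OF assms(1-3)] unfolding Let_def Q_def by metis
  from this[of _ p q] have zero: "infdist (p - q) (parallel_subspace B) = 0" if "B \<in> set As" for B
    using that fixed by simp
  have "p - q \<in> parallel_subspace B" if "B \<in> set As" for B
    using in_closed_iff_infdist_zero zero[OF that] subspace_0
      closed_affine_subspace_parallel[OF assms(1)[OF that]] by blast
  then show ?thesis
    by blast
qed

text \<open>Since \<open>projector\<close> chooses some minimiser, uniqueness is required as well as
  minimality. Pythagoras yields both: any other point of \<open>F\<close> is farther from
  \<open>x\<close> by its distance to \<open>p\<close>, in squares.\<close>

lemma projector_eqI:
  assumes "p \<in> F" and "\<And>q. q \<in> F \<Longrightarrow> (x - p) \<bullet> (p - q) = 0"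
  shows "projector F x = p"
proof -
  have pyth: "(dist x q)\<^sup>2 = (dist x p)\<^sup>2 + (dist p q)\<^sup>2" if "q \<in> F" for q
  proof -
    have "x - q = (x - p) + (p - q)"
      by simp
    then show ?thesis
      using assms(2)[OF that] by (simp only: dist_norm power2_norm_eq_inner inner_add_left
          inner_add_right inner_commute[of "p - q" "x - p"])
  qed
  show ?thesis
    unfolding projector_def
  proof (rule some_equality)
    have "dist x p \<le> dist x c" if "c \<in> F" for c
      by (rule power2_le_imp_le) (simp_all add: pyth[OF that])
    with assms(1) show "p \<in> F \<and> (\<forall>c\<in>F. dist x p \<le> dist x c)"
      by blast
  next
    fix q
    assume q: "q \<in> F \<and> (\<forall>c\<in>F. dist x q \<le> dist x c)"
    then have "(dist x q)\<^sup>2 \<le> (dist x p)\<^sup>2"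
      using assms(1) by (intro power_mono) auto
    then show "q = p"
      using pyth[of q] q by simp
  qed
qed

theorem theorem5p1:
  fixes \<A> :: "'a::{real_inner, banach} set set"
    and \<L> :: "'a set set"
    and lam :: real
    and Q :: "'a \<Rightarrow> 'a"
  assumes "finite \<A>" and "\<A> \<noteq> {}"
    and "\<And>A. A \<in> \<A> \<Longrightarrow> closed_affine_subspace A"
    and "\<L> = parallel_subspace ` \<A>"
    and "innately_regular \<L>"
    and "0 < lam" and "lam < 2"
    and "Q \<in> finite_compositions (relaxed_projectors lam \<A>)"
  shows "Fix Q \<noteq> {} \<and>
    (\<forall>x\<^sub>0. converges_linearly (\<lambda>n. (Q ^^ n) x\<^sub>0) (projector (Fix Q) x\<^sub>0))"
proof -
  obtain Rs where "set Rs \<subseteq> relaxed_projector lam ` \<A>" and Rs: "Q = foldr (\<circ>) Rs id"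
    using assms(8) by (auto simp: finite_compositions_def relaxed_projectors_def)
  \<comment> \<open>Pulls the list of maps back to a list of sets in the collection.\<close>
  then have "Rs \<in> map (relaxed_projector lam) ` lists \<A>"
    by (simp add: lists_image[symmetric] in_lists_conv_set subset_iff)
  then obtain As where "set As \<subseteq> \<A>" and Q: "Q = relaxed_composition lam As"
    using Rs by (auto simp: relaxed_composition_def)
  define M where "M = \<Inter>(parallel_subspace ` set As)"
  have affine: "closed_affine_subspace A" if "A \<in> set As" for A
    using that \<open>set As \<subseteq> \<A>\<close> assms(3) by blast
  \<comment> \<open>\<open>Q\<close> may use only some members of the collection; innate regularity
    covers the subcollection of subspaces that occur.\<close>
  have "regular_collection (parallel_subspace ` set As)" if "As \<noteq> []"
  proof -
    have "parallel_subspace ` set As \<subseteq> \<L>"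
      unfolding assms(4) using \<open>set As \<subseteq> \<A>\<close> by (rule image_mono)
    moreover have "parallel_subspace ` set As \<noteq> {}"
      using that by simp
    ultimately show ?thesis
      using assms(5) unfolding innately_regular_def by blast
  qed
  from relaxed_composition_contraction[OF affine assms(6,7) this]
  obtain \<rho> where \<rho>: "0 \<le> \<rho>" "\<rho> < 1"
    and contr: "\<And>x y. x - y \<in> M\<^sup>\<bottom> \<Longrightarrow> norm (Q x - Q y) \<le> \<rho> * norm (x - y)"
    unfolding M_def Q by blast
  have displ: "Q x - x \<in> M\<^sup>\<bottom>" for x
    unfolding M_def Q using affine by (rule relaxed_composition_displacement)
  note sub = subspace_orthogonal_comp[of M]
  have main: "\<exists>p. p \<in> Fix Q \<and> projector (Fix Q) x = p \<and> converges_linearly (\<lambda>n. (Q ^^ n) x) p" for x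
  proof -
    \<comment> \<open>The coset of \<open>x\<close> modulo the orthogonal complement of
      \<open>M\<close>: complete, invariant under \<open>Q\<close>, and with all differences in the
      complement, where \<open>Q\<close> contracts.\<close>
    define S where "S = {y. y - x \<in> M\<^sup>\<bottom>}"
    have "S = (\<lambda>u. x + u) ` (M\<^sup>\<bottom>)"
    proof -
      have "y \<in> (\<lambda>u. x + u) ` (M\<^sup>\<bottom>)" if "y \<in> S" for y
        using that unfolding image_iff by (intro bexI[of _ "y - x"]) (simp_all add: S_def)
      then show ?thesis
        by (auto simp: S_def)
    qed
    then have "complete S"
      by (simp add: complete_eq_closed closed_translation closed_orthogonal_comp)
    have "x \<in> S"
      using subspace_0[OF sub] by (simp add: S_def)
    have diffS: "y - z \<in> M\<^sup>\<bottom>" if "y \<in> S" "z \<in> S" for y z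
      using subspace_diff[OF sub, of "y - x" "z - x"] that by (simp add: S_def)
    have QS: "Q y \<in> S" if "y \<in> S" for y
      using subspace_add[OF sub displ[of y], of "y - x"] that by (simp add: S_def)
    have "\<exists>!p. p \<in> S \<and> Q p = p"
      using \<open>complete S\<close> _ \<rho>
      by (rule Banach_fix) (use \<open>x \<in> S\<close> QS contr diffS in \<open>auto simp: dist_norm\<close>)
    then obtain p where p: "p \<in> S" "Q p = p"
      by blast
    then have "p \<in> Fix Q"
      by (simp add: Fix_def)
    \<comment> \<open>Here \<open>x - p\<close> is orthogonal to \<open>M\<close> because both
      points lie in \<open>S\<close>, while \<open>p - q\<close> is in \<open>M\<close> as a
      difference of fixed points.\<close>
    have "(x - p) \<bullet> (p - q) = 0" if "q \<in> Fix Q" for q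
    proof -
      have "p - q \<in> M"
        using fixed_points_diff_parallel[OF affine assms(6,7)] \<open>p \<in> Fix Q\<close> that
        unfolding M_def Q by blast
      then show ?thesis
        using inner_orthogonal_comp diffS[OF \<open>x \<in> S\<close> p(1)] by (metis inner_commute)
    qed
    with \<open>p \<in> Fix Q\<close> have "projector (Fix Q) x = p"
      by (rule projector_eqI)
    \<comment> \<open>Membership in \<open>S\<close> is carried along because the contraction
      estimate holds only for differences orthogonal to \<open>M\<close>.\<close>
    moreover have "(Q ^^ n) x \<in> S \<and> norm ((Q ^^ n) x - p) \<le> norm (x - p) * \<rho> ^ n" for n
    proof (induction n)
      case 0
      show ?case
        using \<open>x \<in> S\<close> by simp
    next
      case (Suc n)
      have "norm (Q ((Q ^^ n) x) - p) \<le> \<rho> * norm ((Q ^^ n) x - p)"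
        using contr[OF diffS[of "(Q ^^ n) x" p]] Suc p by simp
      also have "\<dots> \<le> \<rho> * (norm (x - p) * \<rho> ^ n)"
        using Suc \<rho>(1) by (intro mult_left_mono) auto
      finally show ?case
        using QS Suc by (simp add: mult_ac)
    qed
    then have "converges_linearly (\<lambda>n. (Q ^^ n) x) p"
      using \<rho> norm_ge_zero[of "x - p"] unfolding converges_linearly_def by blast
    ultimately show ?thesis
      using \<open>p \<in> Fix Q\<close> by blast
  qed
  then show ?thesis
    by blast
qed

end
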